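(* Let $A$ be a generalized Cartan matrix with associated data $\mathfrak h_{\mathbb R}^*,\Pi,W,\overline C$, let $\mu\in\overline C$, and let $H$ be the convex hull of $W\mu$. Then the set $\mathcal F$ of fundamental faces of $H$ is a sublattice of the face lattice $\mathcal F(H)$ of $H$.
   Context: Let $A=(a_{ij})_{i,j=1}^m$ be a generalized Cartan matrix (integral, $a_{ii}=2$, $a_{ij}\le 0$ for $i\ne j$, $a_{ij}=0\Rightarrow a_{ji}=0$) of rank $l$. Let $(\mathfrak h_{\mathbb R},\Pi,\Pi^\vee)$ be a realization of $A$ over $\mathbb R$: $\mathfrak h_{\mathbb R}$ is a real vector space of dimension $2m-l$, and $\Pi=\{\alpha_1,\dots,\alpha_m\}\subset\mathfrak h_{\mathbb R}^*$ and $\Pi^\vee=\{\alpha_1^\vee,\dots,\alpha_m^\vee\}\subset\mathfrak h_{\mathbb R}$ are linearly independent with $\langle\alpha_j,\alpha_i^\vee\rangle=a_{ij}$. The Weyl group $W\subset GL(\mathfrak h_{\mathbb R}^* )$ is generated by the reflections $r_{\alpha_i}(\eta)=\eta-\langle\eta,\alpha_i^\vee\rangle\alpha_i$. The fundamental chamber is $\overline C=\{\eta\in\mathfrak h_{\mathbb R}^*\mid\langle\eta,\alpha^\vee\rangle\ge 0\ \forall\alpha\in\Pi\}$. A face of the convex set $H$ is a convex subset $F\subseteq H$ such that every closed line segment in $H$ having a relative interior point in $F$ has both endpoints in $F$ (so $\emptyset$ and $H$ are faces). $\mathcal F(H)$, the set of all faces ordered by inclusion, is a lattice: the meet of two faces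 is their intersection, the join is the smallest face containing both. A face $F$ is fundamental if $F=\emptyset$ or $\operatorname{ri}(F)\cap\overline C\ne\emptyset$, where $\operatorname{ri}$ denotes relative interior. A subset $L_1$ of a lattice $L$ is a sublattice if, with the induced order, $L_1$ is a lattice with the same smallest and biggest elements and the same lattice operations as in $L$. *)

theory Defs
  imports "HOL-Analysis.Analysis" "HOL-Algebra.Lattice" "HOL-Algebra.Generated_Groups"
begin

definition generalized_cartan_matrix :: "int ^ 'n ^ 'n \<Rightarrow> bool" where
  "generalized_cartan_matrix A \<longleftrightarrow>
     (\<forall>i. A $ i $ i = 2) \<and>
     (\<forall>i j. i \<noteq> j \<longrightarrow> A $ i $ j \<le> 0) \<and>
     (\<forall>i j. A $ i $ j = 0 \<longrightarrow> A $ j $ i = 0)"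

text \<open>
  The type \<open>'h\<close> serves only as a finite-dimensional real vector space: its inner product plays
  no role. Every linear functional on it is bounded, so its dual is \<open>'h \<Rightarrow>\<^sub>L real\<close>, with
  \<open>\<langle>\<eta>, x\<rangle> = blinfun_apply \<eta> x\<close> and the (only) Hausdorff vector space topology. The families \<open>\<alpha>\<close>
  and \<open>\<alpha>c\<close> are the simple roots and simple coroots. The condition \<open>dim = 2m - rank A\<close> is written
  without subtraction.
\<close>

definition realization ::
  "int ^ 'n ^ 'n \<Rightarrow> ('n \<Rightarrow> 'h::euclidean_space \<Rightarrow>\<^sub>L real) \<Rightarrow> ('n \<Rightarrow> 'h) \<Rightarrow> bool" where
  "realization A \<alpha> \<alpha>c \<longleftrightarrow>
     DIM('h) + rank (\<chi> i j. real_of_int (A $ i $ j)) = 2 * CARD('n) \<and>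
     inj \<alpha> \<and> independent (range \<alpha>) \<and>
     inj \<alpha>c \<and> independent (range \<alpha>c) \<and>
     (\<forall>i j. blinfun_apply (\<alpha> j) (\<alpha>c i) = real_of_int (A $ i $ j))"

definition general_linear_group :: "('v::real_vector \<Rightarrow> 'v) monoid" where
  "general_linear_group = \<lparr>carrier = {f. linear f \<and> bij f}, mult = (\<circ>), one = id\<rparr>"

definition simple_reflection ::
  "('n \<Rightarrow> 'h::euclidean_space \<Rightarrow>\<^sub>L real) \<Rightarrow> ('n \<Rightarrow> 'h) \<Rightarrow> 'n \<Rightarrow> ('h \<Rightarrow>\<^sub>L real) \<Rightarrow> ('h \<Rightarrow>\<^sub>L real)" where
  "simple_reflection \<alpha> \<alpha>c i \<eta> = \<eta> - blinfun_apply \<eta> (\<alpha>c i) *\<^sub>R \<alpha> i"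

definition weyl_group ::
  "('n \<Rightarrow> 'h::euclidean_space \<Rightarrow>\<^sub>L real) \<Rightarrow> ('n \<Rightarrow> 'h) \<Rightarrow> (('h \<Rightarrow>\<^sub>L real) \<Rightarrow> ('h \<Rightarrow>\<^sub>L real)) set" where
  "weyl_group \<alpha> \<alpha>c = generate general_linear_group (range (simple_reflection \<alpha> \<alpha>c))"

definition fundamental_chamber :: "('n \<Rightarrow> 'h::euclidean_space) \<Rightarrow> ('h \<Rightarrow>\<^sub>L real) set" where
  "fundamental_chamber \<alpha>c = {\<eta>. \<forall>i. 0 \<le> blinfun_apply \<eta> (\<alpha>c i)}"

definition weight_hull ::
  "('n \<Rightarrow> 'h::euclidean_space \<Rightarrow>\<^sub>L real) \<Rightarrow> ('n \<Rightarrow> 'h) \<Rightarrow> ('h \<Rightarrow>\<^sub>L real) \<Rightarrow> ('h \<Rightarrow>\<^sub>L real) set" where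
  "weight_hull \<alpha> \<alpha>c \<mu> = convex hull ((\<lambda>w. w \<mu>) ` weyl_group \<alpha> \<alpha>c)"

definition face_lattice :: "'v::real_vector set \<Rightarrow> 'v set gorder" where
  "face_lattice H = \<lparr>carrier = {F. F face_of H}, eq = (=), le = (\<subseteq>)\<rparr>"

definition fundamental_faces ::
  "('n \<Rightarrow> 'h::euclidean_space) \<Rightarrow> ('h \<Rightarrow>\<^sub>L real) set \<Rightarrow> ('h \<Rightarrow>\<^sub>L real) set set" where
  "fundamental_faces \<alpha>c H =
     {F. F face_of H \<and> (F = {} \<or> rel_interior F \<inter> fundamental_chamber \<alpha>c \<noteq> {})}"

text \<open>
  The ambient order \<open>L\<close> is required to be a bounded lattice itself; otherwise its join, meet,
  bottom and top would be unspecified.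
\<close>

definition sublattice :: "'a set \<Rightarrow> ('a, 'b) gorder_scheme \<Rightarrow> bool" where
  "sublattice S L \<longleftrightarrow>
     bounded_lattice L \<and> S \<subseteq> carrier L \<and>
     (let L1 = L\<lparr>carrier := S\<rparr> in
        bounded_lattice L1 \<and>
        \<bottom>\<^bsub>L1\<^esub> = \<bottom>\<^bsub>L\<^esub> \<and> \<top>\<^bsub>L1\<^esub> = \<top>\<^bsub>L\<^esub> \<and>
        (\<forall>x\<in>S. \<forall>y\<in>S. x \<squnion>\<^bsub>L1\<^esub> y = x \<squnion>\<^bsub>L\<^esub> y \<and> x \<sqinter>\<^bsub>L1\<^esub> y = x \<sqinter>\<^bsub>L\<^esub> y))"

end

theory Submission
  imports Defs
begin

text \<open>
  Call a step \<open>x \<mapsto> r\<^sub>i x\<close> with \<open>\<langle>x, \<alpha>\<^sub>i\<^sup>\<or>\<rangle> < 0\<close> a firing (Mozes' numbers game). By a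
  computation in rank two, two firings of the same point either can be completed by equally many
  firings to a common point, or start an infinite sequence of firings. Hence all firing sequences
  from a point of the orbit of a dominant \<open>t\<close> end in \<open>t\<close>, and an orbit contains at most one
  dominant point. So no real coroot vanishes at a strictly dominant point, each real coroot is
  positive or negative, and finitely many positive ones are negative at a given point of \<open>H\<close>; as
  each firing decreases their number, firing any point of \<open>H\<close> ends in the fundamental chamber.

  Let \<open>F\<close> be a fundamental face, \<open>x \<in> ri F\<close> dominant, and \<open>z \<in> F\<close> with
  \<open>\<langle>z, \<alpha>\<^sub>i\<^sup>\<or>\<rangle> < 0\<close>. The segment from \<open>x\<close> to \<open>z\<close> contains a point of \<open>ri F\<close> fixed
  by \<open>r\<^sub>i\<close>, so \<open>r\<^sub>i F = F\<close>. Therefore firing a point of \<open>ri (F \<inter> G)\<close>, with \<open>F\<close> and \<open>G\<close>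
  fundamental, stays in \<open>ri (F \<inter> G)\<close> and reaches a dominant point. For the join, the midpoint of
  dominant points of \<open>ri F\<close> and \<open>ri G\<close> is a dominant point of its relative interior.
\<close>

section \<open>Faces and relative interiors in the dual space\<close>

text \<open>A linear isometry carries balls cut down to an affine hull to balls cut down to its
  image. Applied to \<open>blinfun_inner_right\<close>, this moves facts about relative interiors
  from the Euclidean space \<open>'h\<close> to its dual.\<close>

lemma rel_interior_isometry_image:
  fixes f :: "'a::real_normed_vector \<Rightarrow> 'b::real_normed_vector"
  assumes f: "linear f" and norm: "\<And>x. norm (f x) = norm x"
  shows "rel_interior (f ` S) = f ` rel_interior S"
proof -
  have inj: "inj f"
    unfolding linear_injective_0[OF f] using norm by (metis norm_eq_zero)
  have dist: "dist (f x) (f y) = dist x y" for x y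
    by (simp add: dist_norm norm flip: linear_diff[OF f])
  have aff: "affine hull (f ` S) = f ` (affine hull S)"
    by (rule affine_hull_linear_image[symmetric], rule bounded_linear_intro[of f 1])
      (simp_all add: f norm linear_add linear_scale)
  have "ball (f x) e \<inter> f ` (affine hull S) = f ` (ball x e \<inter> affine hull S)" for x e
    by (auto simp: dist)
  then have ball: "ball (f x) e \<inter> f ` (affine hull S) \<subseteq> f ` S \<longleftrightarrow> ball x e \<inter> affine hull S \<subseteq> S" for x e
    by (simp only: inj_image_subset_iff[OF inj])
  show ?thesis
    by (auto simp: mem_rel_interior_ball aff ball inj_image_mem_iff[OF inj]) blast
qed

section \<open>Transfer to the dual along the Riesz isometry\<close>

lemma linear_blinfun_inner_right: "linear blinfun_inner_right"
  by (intro bounded_linear.linear bounded_linear_blinfun_inner_right)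

lemma norm_blinfun_inner_right: "norm (blinfun_inner_right x) = norm x"
proof (cases "x = 0")
  case True
  then show ?thesis by (simp add: linear_0 linear_blinfun_inner_right)
next
  case False
  show ?thesis
  proof (rule antisym)
    show "norm (blinfun_inner_right x) \<le> norm x"
      by (rule norm_blinfun_bound) (auto simp: Cauchy_Schwarz_ineq2)
    \<comment> \<open>Testing the functional on \<open>x\<close> itself gives the lower
      bound.\<close>
    have "norm x * norm x \<le> norm (blinfun_inner_right x) * norm x"
      using norm_blinfun[of "blinfun_inner_right x" x] by (simp add: dot_square_norm power2_eq_square)
    then show "norm x \<le> norm (blinfun_inner_right x)"
      using False by simp
  qed
qed

lemma inj_blinfun_inner_right: "inj blinfun_inner_right"
  unfolding linear_injective_0[OF linear_blinfun_inner_right]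
  by (metis norm_blinfun_inner_right norm_eq_zero)

lemma surj_blinfun_inner_right:
  "surj (blinfun_inner_right :: 'h::euclidean_space \<Rightarrow> 'h \<Rightarrow>\<^sub>L real)"
proof -
  \<comment> \<open>The Riesz representative has the values of \<eta> on the basis as
    coordinates.\<close>
  have "\<eta> = blinfun_inner_right (\<Sum>b\<in>Basis. \<eta> b *\<^sub>R b)" for \<eta> :: "'h \<Rightarrow>\<^sub>L real"
    by (rule blinfun_euclidean_eqI) (simp add: inner_sum_left inner_Basis if_distrib cong: if_cong)
  then show ?thesis by (metis surj_def)
qed

lemma blinfun_set_eq_image:
  fixes S :: "('h::euclidean_space \<Rightarrow>\<^sub>L real) set"
  obtains T where "S = blinfun_inner_right ` T" "convex S \<longleftrightarrow> convex T"
proof -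
  have S: "S = blinfun_inner_right ` (blinfun_inner_right -` S)"
    by (simp add: image_vimage_eq surj_blinfun_inner_right)
  show ?thesis
    by (rule that[OF S])
      (subst (1) S, rule convex_linear_image_eq[OF linear_blinfun_inner_right inj_blinfun_inner_right])
qed

lemma rel_interior_blinfun_eq_empty:
  fixes S :: "('h::euclidean_space \<Rightarrow>\<^sub>L real) set"
  assumes "convex S"
  shows "rel_interior S = {} \<longleftrightarrow> S = {}"
proof -
  obtain T where "S = blinfun_inner_right ` T" "convex T"
    using assms by (metis blinfun_set_eq_image)
  then show ?thesis
    by (simp add: rel_interior_isometry_image linear_blinfun_inner_right norm_blinfun_inner_right
        rel_interior_eq_empty)
qed

text \<open>The right-hand side uses only the affine structure, so a linear bijection preserving
  \<open>S\<close> also preserves its relative interior, isometry or not. The conjunct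
  \<open>x \<in> S\<close> covers empty \<open>S\<close>.\<close>

lemma rel_interior_blinfun_iff:
  fixes S :: "('h::euclidean_space \<Rightarrow>\<^sub>L real) set"
  assumes "convex S"
  shows "x \<in> rel_interior S \<longleftrightarrow> x \<in> S \<and> (\<forall>y\<in>S. \<exists>e>1. (1 - e) *\<^sub>R y + e *\<^sub>R x \<in> S)"
proof -
  let ?f = "blinfun_inner_right :: 'h \<Rightarrow> 'h \<Rightarrow>\<^sub>L real"
  obtain T where S: "S = ?f ` T" and T: "convex T"
    using assms by (metis blinfun_set_eq_image)
  have inj: "inj ?f" by (rule inj_blinfun_inner_right)
  have T_iff: "z \<in> rel_interior T \<longleftrightarrow> z \<in> T \<and> (\<forall>y\<in>T. \<exists>e>1. (1 - e) *\<^sub>R y + e *\<^sub>R z \<in> T)" for z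
  proof (cases "T = {}")
    case False
    then show ?thesis
      using convex_rel_interior_iff[OF T False] rel_interior_subset[of T] by blast
  qed auto
  obtain z where x: "x = ?f z"
    using surj_blinfun_inner_right by (metis surjD)
  have comb: "(1 - e) *\<^sub>R ?f y + e *\<^sub>R ?f z = ?f ((1 - e) *\<^sub>R y + e *\<^sub>R z)" for y e
    by (simp add: linear_add linear_scale linear_blinfun_inner_right)
  show ?thesis
    unfolding S x
    by (simp add: rel_interior_isometry_image linear_blinfun_inner_right norm_blinfun_inner_right
        inj inj_image_mem_iff comb T_iff)
qed

lemma rel_interior_blinfun_segment:
  fixes S :: "('h::euclidean_space \<Rightarrow>\<^sub>L real) set"
  assumes S: "convex S" and x: "x \<in> rel_interior S" and z: "z \<in> S" and t: "0 < t" "t \<le> 1"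
  shows "t *\<^sub>R x + (1 - t) *\<^sub>R z \<in> rel_interior S"
proof -
  let ?f = "blinfun_inner_right :: 'h \<Rightarrow> 'h \<Rightarrow>\<^sub>L real"
  obtain T where ST: "S = ?f ` T" and T: "convex T"
    using assms by (metis blinfun_set_eq_image)
  have ri: "rel_interior S = ?f ` rel_interior T"
    by (simp add: ST rel_interior_isometry_image linear_blinfun_inner_right norm_blinfun_inner_right)
  obtain x' z' where x': "x = ?f x'" "x' \<in> rel_interior T" and z': "z = ?f z'" "z' \<in> T"
    using x z ri ST by auto
  have "z' - t *\<^sub>R (z' - x') \<in> rel_interior T"
    using rel_interior_convex_shrink[OF T x'(2) z'(2) t] .
  moreover have "?f (z' - t *\<^sub>R (z' - x')) = t *\<^sub>R x + (1 - t) *\<^sub>R z"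
    by (simp add: x' z' linear_add linear_diff linear_scale linear_blinfun_inner_right algebra_simps)
  ultimately show ?thesis
    using ri by (metis image_eqI)
qed

text \<open>A supporting hyperplane at \<open>z\<close> that misses the nonempty relative interior
  cuts out the proper face.\<close>

lemma proper_face_if_not_rel_interior:
  fixes S :: "('h::euclidean_space \<Rightarrow>\<^sub>L real) set"
  assumes S: "convex S" and z: "z \<in> S" "z \<notin> rel_interior S"
  obtains T where "T face_of S" "z \<in> T" "T \<noteq> S"
proof -
  let ?f = "blinfun_inner_right :: 'h \<Rightarrow> 'h \<Rightarrow>\<^sub>L real"
  have lin: "linear ?f" by (rule linear_blinfun_inner_right)
  have inj: "inj ?f" by (rule inj_blinfun_inner_right)
  obtain T where ST: "S = ?f ` T" and T: "convex T"
    using assms by (metis blinfun_set_eq_image)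
  obtain z' where z': "z = ?f z'" "z' \<in> T" "z' \<notin> rel_interior T"
    using z ST by (auto simp: rel_interior_isometry_image linear_blinfun_inner_right norm_blinfun_inner_right)
  obtain a where a: "\<And>y. y \<in> T \<Longrightarrow> a \<bullet> z' \<le> a \<bullet> y" "\<And>y. y \<in> rel_interior T \<Longrightarrow> a \<bullet> z' < a \<bullet> y"
    using supporting_hyperplane_rel_boundary[OF T z'(2,3)] closure_subset by metis
  let ?F = "T \<inter> {y. a \<bullet> y = a \<bullet> z'}"
  have "?F face_of T"
    by (rule face_of_Int_supporting_hyperplane_ge) (use T a in auto)
  moreover have "?F \<noteq> T"
    using a(2) T z'(2) rel_interior_eq_empty[of T] rel_interior_subset[of T] by force
  ultimately show ?thesis
    using that[of "?f ` ?F"] z' inj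
    by (simp add: ST face_of_linear_image[OF lin inj] inj_image_eq_iff)
qed

section \<open>Joins of faces and the sublattice criterion\<close>

definition face_join :: "'v::real_vector set \<Rightarrow> 'v set \<Rightarrow> 'v set \<Rightarrow> 'v set" where
  "face_join H F G = \<Inter>{T. T face_of H \<and> F \<union> G \<subseteq> T}"

lemma face_join_face_of:
  assumes "convex H" "F face_of H" "G face_of H"
  shows "face_join H F G face_of H"
  unfolding face_join_def
  by (rule face_of_Inter) (use assms in \<open>auto simp: face_of_refl dest: face_of_imp_subset intro!: exI[of _ H]\<close>)

lemma subset_face_join: "F \<subseteq> face_join H F G" "G \<subseteq> face_join H F G"
  by (auto simp: face_join_def)

lemma face_join_least: "T face_of H \<Longrightarrow> F \<subseteq> T \<Longrightarrow> G \<subseteq> T \<Longrightarrow> face_join H F G \<subseteq> T"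
  by (auto simp: face_join_def)

lemma face_join_empty_left: "F face_of H \<Longrightarrow> face_join H {} F = F"
  and face_join_empty_right: "F face_of H \<Longrightarrow> face_join H F {} = F"
  by (auto simp: face_join_def)

text \<open>Both the set of all faces and the set of fundamental faces are instances of
  \<open>S\<close>. The formulas for extreme elements and operations do not mention
  \<open>S\<close>, so the two lattices agree on them.\<close>

lemma bounded_lattice_faces:
  fixes H :: "'v::real_vector set"
  assumes H: "convex H" and S: "S \<subseteq> {F. F face_of H}" "{} \<in> S" "H \<in> S"
    and int: "\<And>F G. F \<in> S \<Longrightarrow> G \<in> S \<Longrightarrow> F \<inter> G \<in> S"
    and join: "\<And>F G. F \<in> S \<Longrightarrow> G \<in> S \<Longrightarrow> face_join H F G \<in> S"
  defines "L \<equiv> \<lparr>carrier = S, eq = (=), le = (\<subseteq>)\<rparr>"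
  shows "bounded_lattice L" and "\<bottom>\<^bsub>L\<^esub> = {}" and "\<top>\<^bsub>L\<^esub> = H"
    and "\<And>F G. F \<in> S \<Longrightarrow> G \<in> S \<Longrightarrow> F \<squnion>\<^bsub>L\<^esub> G = face_join H F G"
    and "\<And>F G. F \<in> S \<Longrightarrow> G \<in> S \<Longrightarrow> F \<sqinter>\<^bsub>L\<^esub> G = F \<inter> G"
proof -
  have po: "partial_order L"
    unfolding L_def by unfold_locales auto
  have sup: "least L (face_join H F G) (Upper L {F, G})" if "F \<in> S" "G \<in> S" for F G
  proof -
    have "F \<subseteq> face_join H F G" "G \<subseteq> face_join H F G"
      by (rule subset_face_join)+
    moreover have "face_join H F G \<subseteq> T" if "T \<in> S" "F \<subseteq> T" "G \<subseteq> T" for T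
      using that S(1) by (intro face_join_least) auto
    ultimately show ?thesis
      using that join[OF that] by (simp add: L_def least_def Upper_def)
  qed
  have inf: "greatest L (F \<inter> G) (Lower L {F, G})" if "F \<in> S" "G \<in> S" for F G
    using that int by (auto simp: L_def greatest_def Lower_def)
  have bot: "least L {} (carrier L)"
    using S by (auto simp: L_def least_def)
  have top: "greatest L H (carrier L)"
    using S face_of_imp_subset by (auto simp: L_def greatest_def)
  interpret partial_order L by (rule po)
  show "bounded_lattice L"
  proof unfold_locales
    have carr: "carrier L = S" by (simp add: L_def)
    show "\<exists>s. least L s (Upper L {x, y})" "\<exists>s. greatest L s (Lower L {x, y})"
      if "x \<in> carrier L" "y \<in> carrier L" for x y
      using sup inf that unfolding carr by blast+
    show "\<exists>x. least L x (carrier L)" "\<exists>x. greatest L x (carrier L)"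
      using bot top by blast+
  qed
  \<comment> \<open>Extreme elements and operations are Hilbert choices, pinned down by uniqueness
    of least and greatest elements in a partial order.\<close>
  show "\<bottom>\<^bsub>L\<^esub> = {}"
    unfolding bottom_def by (rule some_equality) (use bot least_unique in auto)
  show "\<top>\<^bsub>L\<^esub> = H"
    unfolding top_def by (rule some_equality) (use top greatest_unique in auto)
  show "F \<squnion>\<^bsub>L\<^esub> G = face_join H F G" if "F \<in> S" "G \<in> S" for F G
    unfolding join_def sup_def by (rule some_equality) (use sup[OF that] least_unique in auto)
  show "F \<sqinter>\<^bsub>L\<^esub> G = F \<inter> G" if "F \<in> S" "G \<in> S" for F G
    unfolding meet_def inf_def by (rule some_equality) (use inf[OF that] greatest_unique in auto)
qed

lemma sublattice_face_latticeI:
  fixes H :: "'v::real_vector set"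
  assumes H: "convex H" and S: "S \<subseteq> {F. F face_of H}" "{} \<in> S" "H \<in> S"
    and int: "\<And>F G. F \<in> S \<Longrightarrow> G \<in> S \<Longrightarrow> F \<inter> G \<in> S"
    and join: "\<And>F G. F \<in> S \<Longrightarrow> G \<in> S \<Longrightarrow> face_join H F G \<in> S"
  shows "sublattice S (face_lattice H)"
proof -
  have eq: "(face_lattice H)\<lparr>carrier := S\<rparr> = \<lparr>carrier = S, eq = (=), le = (\<subseteq>)\<rparr>"
    by (simp add: face_lattice_def)
  note L = bounded_lattice_faces[OF H order_refl _ _ , folded face_lattice_def, simplified,
      OF face_of_refl[OF H] face_of_Int face_join_face_of[OF H]]
  note L1 = bounded_lattice_faces[OF assms]
  show ?thesis
    unfolding sublattice_def Let_def eq using L L1 S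
    by (auto simp: face_lattice_def subset_iff)
qed

section \<open>The numbers game\<close>

text \<open>The indices are transposed: \<open>\<alpha> i (\<alpha>c j)\<close> is the matrix entry
  in row \<open>j\<close> and column \<open>i\<close>.\<close>

locale reflection_datum =
  fixes \<alpha> :: "'n::finite \<Rightarrow> 'h::euclidean_space \<Rightarrow>\<^sub>L real" and \<alpha>c :: "'n \<Rightarrow> 'h"
  assumes diag: "\<And>i. \<alpha> i (\<alpha>c i) = 2"
    and integral: "\<And>i j. \<alpha> i (\<alpha>c j) \<in> \<int>"
    and offdiag_nonpos: "\<And>i j. i \<noteq> j \<Longrightarrow> \<alpha> i (\<alpha>c j) \<le> 0"
    and zero_sym: "\<And>i j. \<alpha> i (\<alpha>c j) = 0 \<Longrightarrow> \<alpha> j (\<alpha>c i) = 0"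
    and inj_coroot: "inj \<alpha>c"
    and independent_coroots: "independent (range \<alpha>c)"
begin

abbreviation refl where "refl \<equiv> simple_reflection \<alpha> \<alpha>c"
abbreviation chamber where "chamber \<equiv> fundamental_chamber \<alpha>c"

lemma refl_eq: "refl i x = x - x (\<alpha>c i) *\<^sub>R \<alpha> i"
  by (simp add: simple_reflection_def)

lemma refl_apply: "refl i x v = x v - x (\<alpha>c i) * \<alpha> i v"
  by (simp add: refl_eq blinfun.diff_left blinfun.scaleR_left)

lemma refl_apply_self: "refl i x (\<alpha>c i) = - x (\<alpha>c i)"
  by (simp add: refl_apply diag)

lemma refl_refl [simp]: "refl i (refl i x) = x"
  by (simp add: refl_eq blinfun.diff_left blinfun.scaleR_left diag)

lemma linear_refl: "linear (refl i)"
  by (rule linearI)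
    (simp_all add: refl_eq blinfun.add_left blinfun.scaleR_left algebra_simps)

lemma bij_refl: "bij (refl i)"
  by (rule involuntory_imp_bij) simp

definition fires :: "('h \<Rightarrow>\<^sub>L real) \<Rightarrow> ('h \<Rightarrow>\<^sub>L real) \<Rightarrow> bool" where
  "fires x y \<longleftrightarrow> (\<exists>i. x (\<alpha>c i) < 0 \<and> y = refl i x)"

lemma firesI: "(x :: 'h \<Rightarrow>\<^sub>L real) (\<alpha>c i) < 0 \<Longrightarrow> fires x (refl i x)"
  by (auto simp: fires_def)

lemma chamber_not_fires: "x \<in> chamber \<Longrightarrow> \<not> fires x y"
  by (auto simp: fires_def fundamental_chamber_def not_less)

text \<open>When \<open>\<alpha>\<^sub>i(\<alpha>\<^sub>j\<^sup>\<or>) \<alpha>\<^sub>j(\<alpha>\<^sub>i\<^sup>\<or>) \<ge> 4\<close>, the inequality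
  \<open>-2 y(\<alpha>\<^sub>j\<^sup>\<or>) \<ge> -\<alpha>\<^sub>i(\<alpha>\<^sub>j\<^sup>\<or>) y(\<alpha>\<^sub>i\<^sup>\<or>)\<close> reproduces itself, with \<open>i\<close> and \<open>j\<close> swapped,
  under firing \<open>j\<close>.\<close>

lemma alternating_fires_forever:
  fixes y :: "'h \<Rightarrow>\<^sub>L real"
  assumes "\<alpha> i (\<alpha>c j) * \<alpha> j (\<alpha>c i) \<ge> 4" "i \<noteq> j"
    and "0 < y (\<alpha>c i)" "2 * y (\<alpha>c j) \<le> \<alpha> i (\<alpha>c j) * y (\<alpha>c i)"
  shows "\<exists>z. (fires ^^ k) y z"
  using assms
proof (induction k arbitrary: y i j)
  case 0
  then show ?case by auto
next
  case (Suc k)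
  define b where "b = - \<alpha> i (\<alpha>c j)"
  define c where "c = - \<alpha> j (\<alpha>c i)"
  define u where "u = y (\<alpha>c i)"
  define v where "v = - y (\<alpha>c j)"
  have bc: "b * c \<ge> 4" "b \<ge> 0" "c \<ge> 0"
    using Suc.prems offdiag_nonpos[of i j] offdiag_nonpos[of j i] by (auto simp: b_def c_def)
  then have b: "b > 0" "c > 0"
    by (auto simp: less_le)
  have u: "u > 0" and v: "2 * v \<ge> b * u"
    using Suc.prems by (auto simp: b_def u_def v_def)
  have v0: "v > 0"
    using b u v by (smt (verit) mult_pos_pos)
  \<comment> \<open>Firing \<open>j\<close> leads to the values \<open>v\<close> at \<open>j\<close>
    and \<open>u - c * v\<close> at \<open>i\<close>. The swapped inequality for them, 2 (u - c v)
    <= - c v, amounts to c v >= 2 u.\<close>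
  have "c * (2 * v) \<ge> c * (b * u)"
    using v b by (intro mult_left_mono) auto
  moreover have "(b * c) * u \<ge> 4 * u"
    using bc u by (intro mult_right_mono) auto
  ultimately have cv: "c * v \<ge> 2 * u"
    by (simp add: algebra_simps)
  let ?y = "refl j y"
  have yj: "?y (\<alpha>c j) = v" by (simp add: refl_apply_self v_def)
  have yi: "?y (\<alpha>c i) = u - c * v" by (simp add: refl_apply c_def u_def v_def)
  have "\<exists>z. (fires ^^ k) ?y z"
  proof (rule Suc.IH[of j i])
    show "2 * ?y (\<alpha>c i) \<le> \<alpha> j (\<alpha>c i) * ?y (\<alpha>c j)"
      unfolding yi yj using cv by (simp add: c_def algebra_simps)
  qed (use Suc.prems yj v0 in \<open>auto simp: mult.commute\<close>)
  moreover have "fires y ?y"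
    using v0 by (intro firesI) (simp add: v_def)
  ultimately show ?case
    by (meson relpowp_Suc_I2)
qed

section \<open>The finite types of rank two\<close>

text \<open>These are the types A1 x A1, A2, B2 and G2, the last two in both orientations. If the
  integers are nonzero, their product bounds the absolute value of each, which leaves 1, 2 and
  3.\<close>

lemma nonpos_Ints_prod_less_4:
  assumes "x \<in> \<int>" "y \<in> \<int>" "x \<le> 0" "y \<le> 0" "x = 0 \<longleftrightarrow> y = 0" "x * y < (4::real)"
  shows "(x, y) \<in> {(0,0), (-1,-1), (-1,-2), (-2,-1), (-1,-3), (-3,-1)}"
proof -
  obtain a b where ab: "x = of_int a" "y = of_int b" using assms by (auto elim!: Ints_cases)
  have h: "a \<le> 0" "b \<le> 0" "a = 0 \<longleftrightarrow> b = 0" "a * b < 4"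
    using assms unfolding ab by (simp_all flip: of_int_mult)
  show ?thesis
  proof (cases "a = 0")
    case True
    then show ?thesis using h ab by auto
  next
    case False
    then have n: "a \<le> -1" "b \<le> -1" using h by auto
    have "a * b \<ge> - a" "a * b \<ge> - b"
      using mult_left_mono_neg[OF n(2), of a] mult_left_mono_neg[OF n(1), of b] n by (auto simp: mult.commute)
    then have "a \<in> {-1,-2,-3}" "b \<in> {-1,-2,-3}"
      using h n by auto
    then show ?thesis using h ab by auto
  qed
qed

text \<open>Fire \<open>i\<close> and \<open>j\<close> alternately. Both sequences end at the image
  of \<open>x\<close> under the longest element of the dihedral group of the two reflections. That
  element has length 2, 3, 4 or 6, and one firing is already done, so \<open>k\<close> is 1, 2, 3 or
  5.\<close>

lemma fires_meet:
  fixes x :: "'h \<Rightarrow>\<^sub>L real"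
  assumes "x (\<alpha>c i) < 0" "x (\<alpha>c j) < 0"
    and "i \<noteq> j" "\<alpha> i (\<alpha>c j) * \<alpha> j (\<alpha>c i) < 4"
  shows "\<exists>k z. (fires ^^ k) (refl i x) z \<and> (fires ^^ k) (refl j x) z"
proof -
  define b where "b = \<alpha> i (\<alpha>c j)"
  define c where "c = \<alpha> j (\<alpha>c i)"
  define p where "p = - x (\<alpha>c i)"
  define q where "q = - x (\<alpha>c j)"
  have pq: "p > 0" "q > 0" using assms by (auto simp: p_def q_def)
  \<comment> \<open>All these firings stay in the plane through \<open>x\<close> spanned by the two
    roots. In the coordinates \<open>s\<close> and \<open>t\<close>, firing \<open>i\<close> changes
    only \<open>s\<close> and firing \<open>j\<close> only \<open>t\<close>.\<close>
  define P where "P = (\<lambda>s t. x + s *\<^sub>R \<alpha> i + t *\<^sub>R \<alpha> j)"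
  have Pi: "P s t (\<alpha>c i) = - p + 2 * s + c * t" and Pj: "P s t (\<alpha>c j) = - q + b * s + 2 * t" for s t
    by (simp_all add: P_def p_def q_def b_def c_def blinfun.add_left blinfun.scaleR_left diag algebra_simps)
  have fi: "fires (P s t) (P (p - s - c * t) t)" if "- p + 2 * s + c * t < 0" for s t
  proof -
    have "P (p - s - c * t) t = refl i (P s t)"
      unfolding refl_eq Pi by (simp add: P_def algebra_simps scaleR_2 flip: scaleR_add_left)
    then show ?thesis using firesI[of "P s t" i] that Pi by simp
  qed
  have fj: "fires (P s t) (P s (q - t - b * s))" if "- q + b * s + 2 * t < 0" for s t
  proof -
    have "P s (q - t - b * s) = refl j (P s t)"
      unfolding refl_eq Pj by (simp add: P_def algebra_simps scaleR_2 flip: scaleR_add_left)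
    then show ?thesis using firesI[of "P s t" j] that Pj by simp
  qed
  have ri: "refl i x = P p 0" and rj: "refl j x = P 0 q"
    by (simp_all add: refl_eq P_def p_def q_def)
  have cases: "(b, c) \<in> {(0,0), (-1,-1), (-1,-2), (-2,-1), (-1,-3), (-3,-1)}"
    unfolding b_def c_def
    by (rule nonpos_Ints_prod_less_4) (use integral offdiag_nonpos assms zero_sym in auto)
  note fi = relpowp_Suc_I2[of fires, OF fi] and fj = relpowp_Suc_I2[of fires, OF fj]
  have "\<exists>k z. (fires ^^ k) (P p 0) z \<and> (fires ^^ k) (P 0 q) z"
  proof -
    consider "b = 0" "c = 0" | "b = -1" "c = -1" | "b = -1" "c = -2" | "b = -2" "c = -1"
      | "b = -1" "c = -3" | "b = -3" "c = -1"
      using cases by auto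
    then show ?thesis
    proof cases
      case H: 1
      have "(fires ^^ Suc 0) (P p 0) (P p q)"
        by (rule fj, use pq H in \<open>simp; linarith?\<close>,
            simp add: H algebra_simps)
      moreover have "(fires ^^ Suc 0) (P 0 q) (P p q)"
        by (rule fi, use pq H in \<open>simp; linarith?\<close>,
            simp add: H algebra_simps)
      ultimately show ?thesis by blast
    next
      case H: 2
      have "(fires ^^ Suc (Suc 0)) (P p 0) (P (p + q) (p + q))"
        by (rule fj, use pq H in \<open>simp; linarith?\<close>,
            rule fi, use pq H in \<open>simp; linarith?\<close>,
            simp add: H algebra_simps)
      moreover have "(fires ^^ Suc (Suc 0)) (P 0 q) (P (p + q) (p + q))"
        by (rule fi, use pq H in \<open>simp; linarith?\<close>,
            rule fj, use pq H in \<open>simp; linarith?\<close>,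
            simp add: H algebra_simps)
      ultimately show ?thesis by blast
    next
      case H: 3
      have "(fires ^^ Suc (Suc (Suc 0))) (P p 0) (P (2*p + 2*q) (p + 2*q))"
        by (rule fj, use pq H in \<open>simp; linarith?\<close>,
            rule fi, use pq H in \<open>simp; linarith?\<close>,
            rule fj, use pq H in \<open>simp; linarith?\<close>,
            simp add: H algebra_simps)
      moreover have "(fires ^^ Suc (Suc (Suc 0))) (P 0 q) (P (2*p + 2*q) (p + 2*q))"
        by (rule fi, use pq H in \<open>simp; linarith?\<close>,
            rule fj, use pq H in \<open>simp; linarith?\<close>,
            rule fi, use pq H in \<open>simp; linarith?\<close>,
            simp add: H algebra_simps)
      ultimately show ?thesis by blast
    next
      case H: 4
      have "(fires ^^ Suc (Suc (Suc 0))) (P p 0) (P (2*p + q) (2*p + 2*q))"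
        by (rule fj, use pq H in \<open>simp; linarith?\<close>,
            rule fi, use pq H in \<open>simp; linarith?\<close>,
            rule fj, use pq H in \<open>simp; linarith?\<close>,
            simp add: H algebra_simps)
      moreover have "(fires ^^ Suc (Suc (Suc 0))) (P 0 q) (P (2*p + q) (2*p + 2*q))"
        by (rule fi, use pq H in \<open>simp; linarith?\<close>,
            rule fj, use pq H in \<open>simp; linarith?\<close>,
            rule fi, use pq H in \<open>simp; linarith?\<close>,
            simp add: H algebra_simps)
      ultimately show ?thesis by blast
    next
      case H: 5
      have "(fires ^^ Suc (Suc (Suc (Suc (Suc 0))))) (P p 0) (P (4*p + 6*q) (2*p + 4*q))"
        by (rule fj, use pq H in \<open>simp; linarith?\<close>,
            rule fi, use pq H in \<open>simp; linarith?\<close>,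
            rule fj, use pq H in \<open>simp; linarith?\<close>,
            rule fi, use pq H in \<open>simp; linarith?\<close>,
            rule fj, use pq H in \<open>simp; linarith?\<close>,
            simp add: H algebra_simps)
      moreover have "(fires ^^ Suc (Suc (Suc (Suc (Suc 0))))) (P 0 q) (P (4*p + 6*q) (2*p + 4*q))"
        by (rule fi, use pq H in \<open>simp; linarith?\<close>,
            rule fj, use pq H in \<open>simp; linarith?\<close>,
            rule fi, use pq H in \<open>simp; linarith?\<close>,
            rule fj, use pq H in \<open>simp; linarith?\<close>,
            rule fi, use pq H in \<open>simp; linarith?\<close>,
            simp add: H algebra_simps)
      ultimately show ?thesis by blast
    next
      case H: 6
      have "(fires ^^ Suc (Suc (Suc (Suc (Suc 0))))) (P p 0) (P (4*p + 2*q) (6*p + 4*q))"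
        by (rule fj, use pq H in \<open>simp; linarith?\<close>,
            rule fi, use pq H in \<open>simp; linarith?\<close>,
            rule fj, use pq H in \<open>simp; linarith?\<close>,
            rule fi, use pq H in \<open>simp; linarith?\<close>,
            rule fj, use pq H in \<open>simp; linarith?\<close>,
            simp add: H algebra_simps)
      moreover have "(fires ^^ Suc (Suc (Suc (Suc (Suc 0))))) (P 0 q) (P (4*p + 2*q) (6*p + 4*q))"
        by (rule fi, use pq H in \<open>simp; linarith?\<close>,
            rule fj, use pq H in \<open>simp; linarith?\<close>,
            rule fi, use pq H in \<open>simp; linarith?\<close>,
            rule fj, use pq H in \<open>simp; linarith?\<close>,
            rule fi, use pq H in \<open>simp; linarith?\<close>,
            simp add: H algebra_simps)
      ultimately show ?thesis by blast
    qed
  qed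
  then show ?thesis
    unfolding ri rj by blast
qed

lemma fires_diverge_or_meet:
  fixes x :: "'h \<Rightarrow>\<^sub>L real"
  assumes "x (\<alpha>c i) < 0" "x (\<alpha>c j) < 0"
  shows "(\<forall>k. \<exists>y. (fires ^^ k) (refl i x) y) \<or>
    (\<exists>k z. (fires ^^ k) (refl i x) z \<and> (fires ^^ k) (refl j x) z)"
proof -
  consider "i = j" | "i \<noteq> j" "\<alpha> i (\<alpha>c j) * \<alpha> j (\<alpha>c i) \<ge> 4" | "i \<noteq> j" "\<alpha> i (\<alpha>c j) * \<alpha> j (\<alpha>c i) < 4"
    by linarith
  then show ?thesis
  proof cases
    case 1
    then have "(fires ^^ 0) (refl i x) (refl i x) \<and> (fires ^^ 0) (refl j x) (refl i x)" by simp
    then show ?thesis by blast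
  next
    case 2
    \<comment> \<open>After firing \<open>i\<close>, the inequality that starts
      \<open>alternating_fires_forever\<close> reduces to \<open>2 * x (\<alpha>c j) \<le> x
      (\<alpha>c i) * \<alpha> i (\<alpha>c j)\<close>, with negative left and nonnegative right
      side.\<close>
    have "x (\<alpha>c i) * \<alpha> i (\<alpha>c j) \<ge> 0"
      using assms offdiag_nonpos[OF 2(1)] by (simp add: mult_nonpos_nonpos)
    then have "2 * refl i x (\<alpha>c j) \<le> \<alpha> i (\<alpha>c j) * refl i x (\<alpha>c i)"
      using assms(2) unfolding refl_apply_self by (simp add: refl_apply algebra_simps)
    then have "\<exists>y. (fires ^^ k) (refl i x) y" for k
      using 2 assms by (intro alternating_fires_forever[of i j]) (auto simp: refl_apply_self)
    then show ?thesis by blast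
  next
    case 3
    then show ?thesis
      using fires_meet[OF assms] by blast
  qed
qed

section \<open>Confluence and uniqueness of the dominant point of an orbit\<close>

text \<open>Compare \<open>y\<close> with the first point \<open>x'\<close> of the given sequence.
  The induction hypothesis along paths from \<open>x'\<close> bounds their length, so divergence is
  impossible, and a common point reached after \<open>k\<close> firings lies \<open>n' - k\<close>
  firings before \<open>t\<close>.\<close>

lemma fires_from_convergent:
  assumes "(fires ^^ n) x t" "t \<in> chamber" "fires x y"
  shows "\<exists>m. n = Suc m \<and> (fires ^^ m) y t"
  using assms
proof (induction n arbitrary: x y rule: less_induct)
  case (less n)
  then obtain n' where n: "n = Suc n'"
    using chamber_not_fires by (cases n) auto
  obtain x' where x': "fires x x'" "(fires ^^ n') x' t"
    using less.prems(1) unfolding n by (meson relpowp_Suc_D2)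
  have many: "k \<le> n' \<and> (fires ^^ (n' - k)) z t" if "(fires ^^ k) x' z" for k z
    using that
  proof (induction k arbitrary: z)
    case 0
    then show ?case using x' by simp
  next
    case (Suc k)
    then obtain w where w: "(fires ^^ k) x' w" "fires w z" by (meson relpowp_Suc_E)
    have IH: "k \<le> n'" "(fires ^^ (n' - k)) w t" using Suc.IH[OF w(1)] by auto
    have "n' - k < n" using n by simp
    from less.IH[OF this IH(2) less.prems(2) w(2)] obtain m where "n' - k = Suc m" "(fires ^^ m) z t"
      by blast
    moreover from this have "n' - Suc k = m" "Suc k \<le> n'" by auto
    ultimately show ?case by simp
  qed
  obtain i j where i: "x (\<alpha>c i) < 0" "x' = refl i x" and j: "x (\<alpha>c j) < 0" "y = refl j x"
    using x'(1) less.prems(3) by (auto simp: fires_def)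
  consider "\<forall>k. \<exists>z. (fires ^^ k) x' z" | k z where "(fires ^^ k) x' z" "(fires ^^ k) y z"
    using fires_diverge_or_meet[OF i(1) j(1)] i j by auto
  then show ?case
  proof cases
    case 1
    \<comment> \<open>One firing more than \<open>many\<close> allows.\<close>
    then obtain z where "(fires ^^ Suc n') x' z" by blast
    from many[OF this] show ?thesis by simp
  next
    case (2 k z)
    have "k \<le> n'" "(fires ^^ (n' - k)) z t" using many[OF 2(1)] by auto
    then have "(fires ^^ n') y t"
      using relpowp_trans[OF 2(2), of "n' - k" t] by simp
    then show ?thesis using n by blast
  qed
qed

text \<open>The Weyl group orbit, built one simple reflection at a time to allow induction;
  \<open>weyl_group_orbit\<close> identifies it with the orbit of the group.\<close>

inductive orbit :: "('h \<Rightarrow>\<^sub>L real) \<Rightarrow> ('h \<Rightarrow>\<^sub>L real) \<Rightarrow> bool" for x where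
  base: "orbit x x"
| step: "orbit x y \<Longrightarrow> orbit x (refl i y)"

text \<open>A simple reflection applied to \<open>y\<close> is a firing, the identity, or the
  reverse of a firing. In the first case \<open>fires_from_convergent\<close> shortens the sequence
  by one, in the last it grows by one.\<close>

lemma orbit_fires_to_chamber:
  assumes "t \<in> chamber" "orbit t x"
  shows "\<exists>n. (fires ^^ n) x t"
  using assms(2)
proof induction
  case base
  have "(fires ^^ 0) t t" by simp
  then show ?case by blast
next
  case (step y i)
  then obtain n where n: "(fires ^^ n) y t" by blast
  consider "y (\<alpha>c i) < 0" | "y (\<alpha>c i) = 0" | "y (\<alpha>c i) > 0" by linarith
  then show ?case
  proof cases
    case 1
    then show ?thesis
      using fires_from_convergent[OF n assms(1) firesI[OF 1]] by blast
  next
    case 2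
    then have "refl i y = y" by (simp add: refl_eq)
    then show ?thesis using n by metis
  next
    case 3
    then have "fires (refl i y) y"
      using firesI[of "refl i y" i] by (simp add: refl_apply_self)
    then show ?thesis using relpowp_Suc_I2[OF _ n] by blast
  qed
qed

lemma orbit_chamber_unique:
  assumes "t \<in> chamber" "t' \<in> chamber" "orbit t t'"
  shows "t' = t"
proof -
  obtain n where n: "(fires ^^ n) t' t"
    using orbit_fires_to_chamber assms by blast
  then show ?thesis
    using chamber_not_fires[OF assms(2)] by (cases n) (auto simp del: relpowp.simps(2) dest!: relpowp_Suc_D2)
qed

section \<open>Real coroots\<close>

lemma orbit_trans: "orbit y z \<Longrightarrow> orbit x y \<Longrightarrow> orbit x z"
  by (induction rule: orbit.induct) (auto intro: orbit.intros)

definition strictly_dominant :: "('h \<Rightarrow>\<^sub>L real) \<Rightarrow> bool" where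
  "strictly_dominant x \<longleftrightarrow> (\<forall>i. 0 < x (\<alpha>c i))"

lemma strictly_dominant_in_chamber: "strictly_dominant x \<Longrightarrow> x \<in> chamber"
  by (simp add: strictly_dominant_def fundamental_chamber_def less_imp_le)

text \<open>Linear independence of the simple coroots enters here.\<close>

lemma exists_functional:
  obtains x :: "'h \<Rightarrow>\<^sub>L real" where "\<And>i. x (\<alpha>c i) = p i"
proof -
  obtain g :: "'h \<Rightarrow> real" where g: "linear g" "\<forall>v\<in>range \<alpha>c. g v = p (inv_into UNIV \<alpha>c v)"
    using linear_independent_extend[OF independent_coroots, of "\<lambda>v. p (inv_into UNIV \<alpha>c v)"] by blast
  have "blinfun_apply (Blinfun g) (\<alpha>c i) = p i" for i
    using g inj_coroot by (simp add: bounded_linear_Blinfun_apply linear_conv_bounded_linear[symmetric])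
  then show ?thesis by (rule that)
qed

lemma strictly_dominant_perturb:
  assumes "strictly_dominant x"
  shows "\<forall>\<^sub>F e in at_right 0. strictly_dominant (x + e *\<^sub>R z)"
proof -
  have "\<forall>\<^sub>F e in at_right 0. 0 < (x + e *\<^sub>R z) (\<alpha>c i)" for i
  proof -
    have "((\<lambda>e. x (\<alpha>c i) + e * z (\<alpha>c i)) \<longlongrightarrow> x (\<alpha>c i) + 0 * z (\<alpha>c i)) (at_right 0)"
      by (intro tendsto_intros)
    then show ?thesis
      using assms order_tendstoD(1)[of _ "x (\<alpha>c i)" _ 0]
      by (simp add: strictly_dominant_def blinfun.add_left blinfun.scaleR_left)
  qed
  then show ?thesis
    unfolding strictly_dominant_def by (simp add: eventually_all_finite)
qed

text \<open>The transpose of \<open>refl i\<close> under the pairing; see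
  \<open>refl_apply_corefl\<close>.\<close>

definition corefl :: "'n \<Rightarrow> 'h \<Rightarrow> 'h" where
  "corefl i v = v - \<alpha> i v *\<^sub>R \<alpha>c i"

lemma refl_apply_corefl: "refl i x v = x (corefl i v)"
  by (simp add: refl_apply corefl_def blinfun.diff_right blinfun.scaleR_right)

lemma corefl_corefl [simp]: "corefl i (corefl i v) = v"
  by (simp add: corefl_def blinfun.diff_right blinfun.scaleR_right diag)

inductive_set coroots :: "'h set" where
  simple: "\<alpha>c i \<in> coroots"
| corefl: "v \<in> coroots \<Longrightarrow> corefl i v \<in> coroots"

lemma coroot_nonzero: "v \<in> coroots \<Longrightarrow> v \<noteq> 0"
proof (induction rule: coroots.induct)
  case (simple i)
  show ?case using diag[of i] by auto
next
  case (corefl v i)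
  then show ?case
    using corefl_corefl[of i v] by (auto simp: corefl_def)
qed

text \<open>The vector \<open>b\<close> plays the role of the real root belonging to
  \<open>v\<close>. Conjugating by \<open>refl i\<close> replaces \<open>v\<close> by
  \<open>corefl i v\<close> and \<open>b\<close> by \<open>refl i b\<close>.\<close>

lemma coroot_reflection:
  assumes "v \<in> coroots"
  shows "\<exists>b. b \<noteq> 0 \<and> (\<forall>x. orbit x (x - x v *\<^sub>R b))"
  using assms
proof (induction rule: coroots.induct)
  case (simple i)
  have "\<alpha> i \<noteq> 0" using diag[of i] by auto
  moreover have "orbit x (x - x (\<alpha>c i) *\<^sub>R \<alpha> i)" for x
    using orbit.step[OF orbit.base, of x i] by (simp add: refl_eq)
  ultimately show ?case by blast
next
  case (corefl v i)
  then obtain b where b: "b \<noteq> 0" "\<And>x. orbit x (x - x v *\<^sub>R b)" by blast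
  have "refl i b \<noteq> 0"
  proof
    assume "refl i b = 0"
    then have "refl i (refl i b) = 0" by (simp add: linear_0[OF linear_refl])
    then show False using b(1) by simp
  qed
  moreover have "orbit x (x - x (corefl i v) *\<^sub>R refl i b)" for x
  proof -
    have "orbit (refl i x) (refl i (refl i x - refl i x v *\<^sub>R b))"
      using b(2) by (rule orbit.step)
    moreover have "refl i (refl i x - refl i x v *\<^sub>R b) = x - x (corefl i v) *\<^sub>R refl i b"
      by (simp add: linear_diff[OF linear_refl] linear_scale[OF linear_refl] refl_apply_corefl)
    ultimately show ?thesis
      using orbit_trans[of "refl i x" _ x] orbit.step[OF orbit.base] by metis
  qed
  ultimately show ?case by blast
qed

text \<open>If \<open>x\<close> lay on the wall of \<open>v\<close>, the reflection in that wall would map points near \<open>x\<close>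
  to other points of the chamber.\<close>

lemma coroot_nonzero_at_strictly_dominant:
  assumes v: "v \<in> coroots" and x: "strictly_dominant x"
  shows "x v \<noteq> 0"
proof
  assume xv: "x v = 0"
  obtain b where b: "b \<noteq> 0" "\<And>x. orbit x (x - x v *\<^sub>R b)"
    using coroot_reflection[OF v] by blast
  \<comment> \<open>A direction leaving the wall: \<open>y v\<close> is the squared norm of
    \<open>v\<close>.\<close>
  define y where "y = blinfun_inner_right v"
  have yv: "y v \<noteq> 0" using coroot_nonzero[OF v] by (simp add: y_def)
  have "\<forall>\<^sub>F e in at_right (0::real). 0 < e \<and> strictly_dominant (x + e *\<^sub>R y) \<and>
      strictly_dominant (x + e *\<^sub>R (y - y v *\<^sub>R b))"
    by (intro eventually_conj eventually_at_right_less strictly_dominant_perturb x)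
  then obtain e :: real where e: "0 < e" "strictly_dominant (x + e *\<^sub>R y)"
      "strictly_dominant (x + e *\<^sub>R (y - y v *\<^sub>R b))"
    using eventually_happens by (metis (no_types, lifting) trivial_limit_at_right_real)
  have eq: "x + e *\<^sub>R y - (x + e *\<^sub>R y) v *\<^sub>R b = x + e *\<^sub>R (y - y v *\<^sub>R b)"
    by (simp add: xv blinfun.add_left blinfun.scaleR_left algebra_simps)
  have "x + e *\<^sub>R (y - y v *\<^sub>R b) = x + e *\<^sub>R y"
    using orbit_chamber_unique[OF strictly_dominant_in_chamber[OF e(2)]
        strictly_dominant_in_chamber[OF e(3)]] b(2)[of "x + e *\<^sub>R y"] eq by simp
  then show False
    using e(1) yv b(1) by simp
qed

section \<open>Signs and coefficients of coroots\<close>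

definition positive :: "'h \<Rightarrow> bool" where
  "positive v \<longleftrightarrow> (\<forall>x. strictly_dominant x \<longrightarrow> 0 < x v)"

text \<open>Strict dominance is preserved by positive combinations. Two values of opposite sign at
  \<open>v\<close> would combine to a strictly dominant point vanishing at \<open>v\<close>.\<close>

lemma coroot_positive_or_negative:
  assumes "v \<in> coroots"
  shows "positive v \<or> positive (- v)"
proof (rule ccontr)
  assume "\<not> ?thesis"
  then obtain x y where x: "strictly_dominant x" "x v \<le> 0" and y: "strictly_dominant y" "y v \<ge> 0"
    by (auto simp: positive_def not_less blinfun.minus_right)
  have xv: "x v < 0" and yv: "y v > 0"
    using coroot_nonzero_at_strictly_dominant[OF assms] x y by (auto simp: less_le)
  define z where "z = y v *\<^sub>R x + (- x v) *\<^sub>R y"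
  have "strictly_dominant z"
    unfolding strictly_dominant_def
  proof
    fix i
    have "0 < y v * x (\<alpha>c i) + (- x v) * y (\<alpha>c i)"
      using x(1) y(1) xv yv by (intro add_pos_pos mult_pos_pos) (auto simp: strictly_dominant_def)
    then show "0 < z (\<alpha>c i)"
      by (simp add: z_def blinfun.add_left blinfun.diff_left blinfun.scaleR_left)
  qed
  moreover have "z v = 0"
    by (simp add: z_def blinfun.add_left blinfun.diff_left blinfun.scaleR_left)
  ultimately show False
    using coroot_nonzero_at_strictly_dominant[OF assms] by blast
qed

lemma corefl_sum:
  assumes "v = (\<Sum>j\<in>UNIV. k j *\<^sub>R \<alpha>c j)"
  shows "corefl i v = (\<Sum>j\<in>UNIV. (k j - (if j = i then \<alpha> i v else 0)) *\<^sub>R \<alpha>c j)"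
proof -
  have "(\<Sum>j\<in>UNIV. (if j = i then \<alpha> i v else 0) *\<^sub>R \<alpha>c j) = (\<Sum>j\<in>UNIV. if j = i then \<alpha> i v *\<^sub>R \<alpha>c i else 0)"
    by (rule sum.cong) auto
  then show ?thesis
    by (simp add: corefl_def scaleR_diff_left sum_subtractf assms[symmetric])
qed

lemma coroot_sum:
  assumes "v \<in> coroots"
  shows "\<exists>k. v = (\<Sum>j\<in>UNIV. k j *\<^sub>R \<alpha>c j)"
  using assms
proof (induction rule: coroots.induct)
  case (simple i)
  have "(\<Sum>j\<in>UNIV. (if j = i then 1 else 0) *\<^sub>R \<alpha>c j) = (\<Sum>j\<in>UNIV. if j = i then \<alpha>c i else 0)"
    by (rule sum.cong) auto
  then show ?case
    by (intro exI[of _ "\<lambda>j. if j = i then 1 else 0"]) simp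
next
  case (corefl v i)
  then obtain k where "v = (\<Sum>j\<in>UNIV. k j *\<^sub>R \<alpha>c j)" by blast
  then show ?case
    by (intro exI[of _ "\<lambda>j. k j - (if j = i then \<alpha> i v else 0)"]) (rule corefl_sum)
qed

lemma positive_coeff_nonneg:
  assumes "positive (\<Sum>j\<in>UNIV. k j *\<^sub>R \<alpha>c j)"
  shows "0 \<le> k i"
proof (rule ccontr)
  assume neg: "\<not> 0 \<le> k i"
  \<comment> \<open>Chosen so that \<open>k i * T\<close> equals \<open>k i\<close> minus the sum of
    all absolute values, which outweighs the other terms.\<close>
  define T where "T = 1 + (\<Sum>j\<in>UNIV. \<bar>k j\<bar>) / (- k i)"
  obtain x :: "'h \<Rightarrow>\<^sub>L real" where x: "\<And>j. x (\<alpha>c j) = (if j = i then T else 1)"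
    using exists_functional[of "\<lambda>j. if j = i then T else 1"] by blast
  have "T > 0"
    unfolding T_def using neg by (intro add_pos_nonneg divide_nonneg_nonneg sum_nonneg) auto
  then have "strictly_dominant x"
    by (simp add: strictly_dominant_def x)
  then have "0 < (\<Sum>j\<in>UNIV. k j * x (\<alpha>c j))"
    using assms by (simp add: positive_def blinfun.sum_right blinfun.scaleR_right)
  also have "\<dots> = k i * T + (\<Sum>j\<in>UNIV - {i}. k j)"
    by (subst sum.remove[of _ i]) (auto simp: x intro!: sum.cong)
  also have "\<dots> \<le> k i * T + (\<Sum>j\<in>UNIV. \<bar>k j\<bar>)"
    by (intro add_left_mono order_trans[OF sum_mono sum_mono2]) auto
  also have "\<dots> = k i"
    using neg by (simp add: T_def field_simps)
  finally show False using neg by simp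
qed

text \<open>Only the coefficient at \<open>i\<close> changes under \<open>corefl i\<close>. If the
  result is negative, every other coefficient is both nonnegative and nonpositive.\<close>

lemma positive_corefl:
  assumes v: "v \<in> coroots" "positive v" and neg: "\<not> positive (corefl i v)"
  shows "\<exists>c>0. v = c *\<^sub>R \<alpha>c i"
proof -
  obtain k where k: "v = (\<Sum>j\<in>UNIV. k j *\<^sub>R \<alpha>c j)"
    using coroot_sum[OF v(1)] by blast
  have "- corefl i v = (\<Sum>j\<in>UNIV. (- (k j - (if j = i then \<alpha> i v else 0))) *\<^sub>R \<alpha>c j)"
    unfolding corefl_sum[OF k] by (simp only: scaleR_minus_left sum_negf)
  moreover have "positive (- corefl i v)"
    using coroot_positive_or_negative[OF coroots.corefl[OF v(1)]] neg by blast
  ultimately have "0 \<le> - (k j - (if j = i then \<alpha> i v else 0))" for j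
    using positive_coeff_nonneg[of "\<lambda>j. - (k j - (if j = i then \<alpha> i v else 0))"] by simp
  moreover have nonneg: "0 \<le> k j" for j
    using positive_coeff_nonneg v(2) k by blast
  ultimately have "k j = 0" if "j \<noteq> i" for j
    using that by (metis antisym diff_zero neg_0_le_iff_le)
  then have "v = (\<Sum>j\<in>UNIV. if j = i then k i *\<^sub>R \<alpha>c i else 0)"
    unfolding k by (intro sum.cong) auto
  then have v_eq: "v = k i *\<^sub>R \<alpha>c i" by simp
  then have "k i \<noteq> 0" using coroot_nonzero[OF v(1)] by auto
  then show ?thesis using v_eq nonneg[of i] by (auto simp: less_le)
qed

text \<open>Replacing each positive coroot by its open negative half-space identifies positive multiples
  of the same coroot, so their number need not be controlled.\<close>

definition halfspace :: "'h \<Rightarrow> ('h \<Rightarrow>\<^sub>L real) set" where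
  "halfspace v = {x. blinfun_apply x v < 0}"

definition negatives :: "('h \<Rightarrow>\<^sub>L real) \<Rightarrow> ('h \<Rightarrow>\<^sub>L real) set set" where
  "negatives x = halfspace ` {v \<in> coroots. positive v \<and> x v < 0}"

lemma halfspace_corefl: "halfspace v = refl i ` halfspace (corefl i v)"
proof -
  have "x \<in> refl i ` halfspace (corefl i v)" if "x \<in> halfspace v" for x
    using that by (intro image_eqI[of _ _ "refl i x"]) (auto simp: halfspace_def refl_apply_corefl)
  then show ?thesis
    by (auto simp: halfspace_def refl_apply_corefl)
qed

lemma halfspace_scale: "c > 0 \<Longrightarrow> halfspace (c *\<^sub>R v) = halfspace v"
  by (auto simp: halfspace_def blinfun.scaleR_right mult_less_0_iff)

text \<open>Either \<open>corefl i v\<close> is again positive, and its half-space belongs to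
  \<open>x\<close>, or \<open>v\<close> is a positive multiple of \<open>\<alpha>c i\<close> and
  shares its half-space.\<close>

lemma negatives_refl_subset:
  "negatives (refl i x) \<subseteq> insert (halfspace (\<alpha>c i)) ((`) (refl i) ` negatives x)"
proof
  fix h assume "h \<in> negatives (refl i x)"
  then obtain v where v: "v \<in> coroots" "positive v" "refl i x v < 0" "h = halfspace v"
    by (auto simp: negatives_def)
  show "h \<in> insert (halfspace (\<alpha>c i)) ((`) (refl i) ` negatives x)"
  proof (cases "positive (corefl i v)")
    case True
    then have "halfspace (corefl i v) \<in> negatives x"
      using v coroots.corefl by (auto simp: negatives_def refl_apply_corefl)
    then show ?thesis using v(4) halfspace_corefl[of v i] by blast
  next
    case False
    then show ?thesis using positive_corefl v halfspace_scale by blast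
  qed
qed

lemma positive_simple: "positive (\<alpha>c i)"
  by (simp add: positive_def strictly_dominant_def)

lemma negatives_refl_subset_if_neg:
  fixes x :: "'h \<Rightarrow>\<^sub>L real"
  assumes "x (\<alpha>c i) < 0"
  shows "negatives (refl i x) \<subseteq> (`) (refl i) ` (negatives x - {halfspace (\<alpha>c i)})"
proof -
  have "halfspace (\<alpha>c i) \<notin> negatives (refl i x)"
  proof
    assume "halfspace (\<alpha>c i) \<in> negatives (refl i x)"
    then have "refl i x \<in> halfspace (\<alpha>c i)"
      by (auto simp: negatives_def halfspace_def)
    then show False using assms by (simp add: halfspace_def refl_apply_self)
  qed
  \<comment> \<open>The image is the opposite half-space. It contains a strictly dominant point, so
    it belongs to no positive coroot.\<close>
  moreover have "refl i ` halfspace (\<alpha>c i) \<notin> negatives (refl i x)"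
  proof
    obtain y :: "'h \<Rightarrow>\<^sub>L real" where y: "\<And>j. y (\<alpha>c j) = 1"
      using exists_functional[of "\<lambda>_. 1"] by blast
    assume "refl i ` halfspace (\<alpha>c i) \<in> negatives (refl i x)"
    then obtain v where v: "positive v" "refl i ` halfspace (\<alpha>c i) = halfspace v"
      by (auto simp: negatives_def)
    have "refl i y \<in> halfspace (\<alpha>c i)"
      by (simp add: halfspace_def refl_apply_self y)
    then have "y \<in> halfspace v"
      using v(2) by (metis image_eqI refl_refl)
    moreover have "strictly_dominant y"
      by (simp add: strictly_dominant_def y)
    ultimately show False
      using v(1) by (auto simp: halfspace_def positive_def)
  qed
  ultimately show ?thesis
    using negatives_refl_subset[of i x] by blast
qed

lemma card_negatives_refl:
  assumes "finite (negatives x)" "x (\<alpha>c i) < 0"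
  shows "finite (negatives (refl i x))" "card (negatives (refl i x)) < card (negatives x)"
proof -
  let ?D = "negatives x - {halfspace (\<alpha>c i)}"
  note sub = negatives_refl_subset_if_neg[OF assms(2)]
  show "finite (negatives (refl i x))"
    using finite_subset[OF sub] assms(1) by blast
  have "halfspace (\<alpha>c i) \<in> negatives x"
    using assms(2) coroots.simple positive_simple by (auto simp: negatives_def)
  then have "card ?D < card (negatives x)"
    using assms(1) by (rule card_Diff1_less[rotated])
  moreover have "card (negatives (refl i x)) \<le> card ?D"
    using card_mono[OF _ sub] card_image_le[of ?D "(`) (refl i)"] assms(1)
    by (meson finite_Diff finite_imageI order_trans)
  ultimately show "card (negatives (refl i x)) < card (negatives x)" by simp
qed

lemma negatives_chamber:
  assumes "x \<in> chamber"
  shows "negatives x = {}"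
proof -
  have False if v: "v \<in> coroots" "positive v" "x v < 0" for v
  proof -
    obtain k where k: "v = (\<Sum>j\<in>UNIV. k j *\<^sub>R \<alpha>c j)"
      using coroot_sum[OF v(1)] by blast
    have "0 \<le> (\<Sum>j\<in>UNIV. k j * x (\<alpha>c j))"
      using positive_coeff_nonneg[of k] v(2) k assms
      by (intro sum_nonneg mult_nonneg_nonneg) (auto simp: fundamental_chamber_def)
    then show False
      using v(3) by (simp add: k blinfun.sum_right blinfun.scaleR_right)
  qed
  then show ?thesis by (auto simp: negatives_def)
qed

lemma finite_negatives_orbit:
  assumes "t \<in> chamber" "orbit t x"
  shows "finite (negatives x)"
  using assms(2)
proof induction
  case base
  then show ?case using negatives_chamber[OF assms(1)] by simp
next
  case (step y i)
  then show ?case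
    using finite_subset[OF negatives_refl_subset] by blast
qed

text \<open>A convex combination is negative at \<open>v\<close> only if one of its points is. Hence
  the points with finite \<open>negatives\<close> form a convex set, which contains the
  orbit.\<close>

lemma finite_negatives_convex_hull:
  assumes "t \<in> chamber" "x \<in> convex hull {y. orbit t y}"
  shows "finite (negatives x)"
proof -
  have "convex {x. finite (negatives x)}"
  proof (rule convexI, clarify)
    fix x y :: "'h \<Rightarrow>\<^sub>L real" and a b :: real
    assume fin: "finite (negatives x)" "finite (negatives y)" and ab: "0 \<le> a" "0 \<le> b" "a + b = 1"
    have "x v < 0 \<or> y v < 0" if "(a *\<^sub>R x + b *\<^sub>R y) v < 0" for v
      using that ab by (auto simp: blinfun.add_left blinfun.scaleR_left)
        (smt (verit) mult_nonneg_nonneg)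
    then have "negatives (a *\<^sub>R x + b *\<^sub>R y) \<subseteq> negatives x \<union> negatives y"
      by (auto simp: negatives_def)
    then show "finite (negatives (a *\<^sub>R x + b *\<^sub>R y))"
      using fin finite_subset by blast
  qed
  then have "convex hull {y. orbit t y} \<subseteq> {x. finite (negatives x)}"
    using finite_negatives_orbit[OF assms(1)] by (intro hull_minimal) auto
  then show ?thesis using assms(2) by blast
qed

lemma firing_stable_meets_chamber:
  assumes "finite (negatives x)" "x \<in> S"
    and stable: "\<And>y i. y \<in> S \<Longrightarrow> y (\<alpha>c i) < 0 \<Longrightarrow> refl i y \<in> S"
  shows "S \<inter> chamber \<noteq> {}"
  using assms(1,2)
proof (induction "card (negatives x)" arbitrary: x rule: less_induct)
  case less
  show ?case
  proof (cases "x \<in> chamber")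
    case True
    then show ?thesis using less.prems by blast
  next
    case False
    then obtain i where i: "x (\<alpha>c i) < 0"
      by (auto simp: fundamental_chamber_def not_le)
    then show ?thesis
      using less.hyps[OF card_negatives_refl(2)[OF less.prems(1) i]
          card_negatives_refl(1)[OF less.prems(1) i]] stable[OF less.prems(2) i] by blast
  qed
qed

section \<open>Fundamental faces\<close>

lemma inv_refl: "inv\<^bsub>general_linear_group\<^esub> refl i = refl i"
  unfolding m_inv_def
proof (rule the_equality)
  have comp: "refl i \<circ> refl i = id" by auto
  show "refl i \<in> carrier general_linear_group \<and>
      refl i \<otimes>\<^bsub>general_linear_group\<^esub> refl i = \<one>\<^bsub>general_linear_group\<^esub> \<and>
      refl i \<otimes>\<^bsub>general_linear_group\<^esub> refl i = \<one>\<^bsub>general_linear_group\<^esub>"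
    using linear_refl bij_refl comp by (simp add: general_linear_group_def)
  show "f = refl i" if "f \<in> carrier general_linear_group \<and>
      refl i \<otimes>\<^bsub>general_linear_group\<^esub> f = \<one>\<^bsub>general_linear_group\<^esub> \<and>
      f \<otimes>\<^bsub>general_linear_group\<^esub> refl i = \<one>\<^bsub>general_linear_group\<^esub>" for f
  proof -
    have "refl i \<circ> f = id" using that by (simp add: general_linear_group_def)
    then have "refl i \<circ> (refl i \<circ> f) = refl i" by simp
    then show ?thesis using comp by (simp add: o_assoc)
  qed
qed

lemma weyl_group_orbit: "(\<lambda>w. w x) ` weyl_group \<alpha> \<alpha>c = {y. orbit x y}"
proof -
  \<comment> \<open>For all points at once, since a product applies its first factor to the image
    under the second.\<close>
  have "\<forall>x. orbit x (w x)" if "w \<in> weyl_group \<alpha> \<alpha>c" for w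
    using that unfolding weyl_group_def
  proof (induction rule: generate.induct)
    case one
    then show ?case by (simp add: general_linear_group_def orbit.base)
  next
    case (incl h)
    then show ?case using orbit.step[OF orbit.base] by auto
  next
    case (inv h)
    then show ?case using orbit.step[OF orbit.base] by (auto simp: inv_refl)
  next
    case (eng h1 h2)
    then show ?case
      using orbit_trans by (fastforce simp: general_linear_group_def)
  qed
  moreover have "\<exists>w\<in>weyl_group \<alpha> \<alpha>c. y = w x" if "orbit x y" for y
    using that
  proof induction
    case base
    have "id \<in> weyl_group \<alpha> \<alpha>c"
      using generate.one[of general_linear_group] by (simp add: weyl_group_def general_linear_group_def)
    then show ?case by (intro bexI[of _ id]) simp_all
  next
    case (step y i)
    then obtain w where w: "w \<in> weyl_group \<alpha> \<alpha>c" "y = w x" by blast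
    have "refl i \<circ> w \<in> weyl_group \<alpha> \<alpha>c"
      using generate.eng[OF generate.incl w(1)[unfolded weyl_group_def], of "refl i"]
      by (simp add: weyl_group_def general_linear_group_def)
    then show ?case using w(2) by (intro bexI[of _ "refl i \<circ> w"]) simp_all
  qed
  ultimately show ?thesis by blast
qed

lemma weight_hull_orbit: "weight_hull \<alpha> \<alpha>c x = convex hull {y. orbit x y}"
  by (simp add: weight_hull_def weyl_group_orbit)

lemma refl_image_image [simp]: "refl i ` refl i ` S = S"
  by (simp add: image_image)

lemma refl_image_weight_hull: "refl i ` weight_hull \<alpha> \<alpha>c x = weight_hull \<alpha> \<alpha>c x"
proof -
  have sub: "refl i ` {y. orbit x y} \<subseteq> {y. orbit x y}"
    using orbit.step by auto
  then have "refl i ` {y. orbit x y} = {y. orbit x y}"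
    using image_mono[OF sub, of "refl i"] by (simp only: refl_image_image)
  then show ?thesis
    unfolding weight_hull_orbit by (simp add: convex_hull_linear_image[OF linear_refl])
qed

section \<open>Faces under simple reflections\<close>

text \<open>The image of \<open>F\<close> is a face of the hull containing the fixed point
  \<open>x\<close> of the relative interior of \<open>F\<close>, so it contains \<open>F\<close>.
  Reflecting once more gives the other inclusion.\<close>

lemma refl_image_face:
  assumes F: "F face_of weight_hull \<alpha> \<alpha>c \<mu>" and x: "x \<in> rel_interior F" "x (\<alpha>c i) = 0"
  shows "refl i ` F = F"
proof -
  have "refl i x = x" using x(2) by (simp add: refl_eq)
  then have "x \<in> refl i ` F"
    using x(1) rel_interior_subset by (metis image_eqI subsetD)
  moreover have "refl i ` F face_of weight_hull \<alpha> \<alpha>c \<mu>"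
    using face_of_linear_image[OF linear_refl bij_is_inj[OF bij_refl], of i F] F
    by (metis refl_image_weight_hull)
  ultimately have "F \<subseteq> refl i ` F"
    using subset_of_face_of face_of_imp_subset[OF F] x(1) by blast
  then show ?thesis
    using image_mono[of F "refl i ` F" "refl i"] unfolding refl_image_image by blast
qed

text \<open>The segment from the dominant point \<open>x\<close> towards \<open>z\<close> meets the wall of \<open>\<alpha>\<^sub>i\<^sup>\<or>\<close> in the
  relative interior of \<open>F\<close>.\<close>

lemma refl_image_fundamental_face:
  assumes F: "F face_of weight_hull \<alpha> \<alpha>c \<mu>" and x: "x \<in> rel_interior F" "x \<in> chamber"
    and z: "z \<in> F" "z (\<alpha>c i) < 0"
  shows "refl i ` F = F"
proof -
  \<comment> \<open>The root of
    \<open>t * x (\<alpha>c i) + (1 - t) * z (\<alpha>c i) = 0\<close>.\<close>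
  define t where "t = - z (\<alpha>c i) / (x (\<alpha>c i) - z (\<alpha>c i))"
  have xi: "x (\<alpha>c i) \<ge> 0" using x(2) by (simp add: fundamental_chamber_def)
  then have "0 < t" "t \<le> 1"
    using z(2) by (simp_all add: t_def divide_simps)
  then have "t *\<^sub>R x + (1 - t) *\<^sub>R z \<in> rel_interior F"
    by (intro rel_interior_blinfun_segment face_of_imp_convex[OF F] x z)
  moreover have "(t *\<^sub>R x + (1 - t) *\<^sub>R z) (\<alpha>c i) = 0"
  proof -
    have "t * (x (\<alpha>c i) - z (\<alpha>c i)) = - z (\<alpha>c i)"
      using xi z(2) by (simp add: t_def)
    moreover have "(t *\<^sub>R x + (1 - t) *\<^sub>R z) (\<alpha>c i) = t * (x (\<alpha>c i) - z (\<alpha>c i)) + z (\<alpha>c i)"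
      unfolding blinfun.add_left blinfun.scaleR_left by (simp add: algebra_simps)
    ultimately show ?thesis by simp
  qed
  ultimately show ?thesis
    by (rule refl_image_face[OF F])
qed

text \<open>Stability makes the relative interior closed under firing, and firing terminates on the
  hull. This serves both the intersection of two fundamental faces and the whole hull.\<close>

lemma rel_interior_meets_chamber:
  assumes \<mu>: "\<mu> \<in> chamber" and E: "convex E" "E \<noteq> {}" "E \<subseteq> weight_hull \<alpha> \<alpha>c \<mu>"
    and stable: "\<And>z i. z \<in> E \<Longrightarrow> z (\<alpha>c i) < 0 \<Longrightarrow> refl i ` E = E"
  shows "rel_interior E \<inter> chamber \<noteq> {}"
proof -
  obtain z where z: "z \<in> rel_interior E"
    using rel_interior_blinfun_eq_empty[OF E(1)] E(2) by blast
  have "refl i y \<in> rel_interior E" if y: "y \<in> rel_interior E" "y (\<alpha>c i) < 0" for y i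
  proof -
    have "y \<in> E" using y(1) rel_interior_subset by blast
    then have inv: "refl i ` E = E" using stable y(2) by blast
    then have mem: "refl i u \<in> E \<longleftrightarrow> u \<in> E" for u
      by (metis image_eqI refl_refl)
    \<comment> \<open>Reflect \<open>u\<close> into \<open>E\<close>, prolong the segment from there
      beyond \<open>y\<close>, and reflect back.\<close>
    have "\<exists>e>1. (1 - e) *\<^sub>R u + e *\<^sub>R refl i y \<in> E" if "u \<in> E" for u
    proof -
      obtain e where e: "e > 1" "(1 - e) *\<^sub>R refl i u + e *\<^sub>R y \<in> E"
        using y(1) rel_interior_blinfun_iff[OF E(1), of y] mem \<open>u \<in> E\<close> by blast
      then have "refl i ((1 - e) *\<^sub>R refl i u + e *\<^sub>R y) \<in> E" by (simp only: mem)
      then show ?thesis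
        using e(1) by (auto simp: linear_add[OF linear_refl] linear_scale[OF linear_refl])
    qed
    then show ?thesis
      using rel_interior_blinfun_iff[OF E(1), of "refl i y"] mem \<open>y \<in> E\<close> by blast
  qed
  moreover have "finite (negatives z)"
    using finite_negatives_convex_hull[OF \<mu>] z rel_interior_subset[of E] E(3)
    unfolding weight_hull_orbit by blast
  ultimately show ?thesis
    using firing_stable_meets_chamber[of z "rel_interior E"] z by blast
qed

lemma fundamental_Int:
  assumes \<mu>: "\<mu> \<in> chamber"
    and F: "F \<in> fundamental_faces \<alpha>c (weight_hull \<alpha> \<alpha>c \<mu>)"
    and G: "G \<in> fundamental_faces \<alpha>c (weight_hull \<alpha> \<alpha>c \<mu>)"
  shows "F \<inter> G \<in> fundamental_faces \<alpha>c (weight_hull \<alpha> \<alpha>c \<mu>)"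
proof (cases "F \<inter> G = {}")
  case True
  then show ?thesis by (simp add: fundamental_faces_def)
next
  case False
  let ?H = "weight_hull \<alpha> \<alpha>c \<mu>"
  obtain x y where F': "F face_of ?H" "x \<in> rel_interior F" "x \<in> chamber"
    and G': "G face_of ?H" "y \<in> rel_interior G" "y \<in> chamber"
    using F G False by (auto simp: fundamental_faces_def)
  have face: "F \<inter> G face_of ?H" using F'(1) G'(1) by (rule face_of_Int)
  have "rel_interior (F \<inter> G) \<inter> chamber \<noteq> {}"
  proof (rule rel_interior_meets_chamber[OF \<mu> face_of_imp_convex[OF face] False face_of_imp_subset[OF face]])
    fix z i assume "z \<in> F \<inter> G" and neg: "z (\<alpha>c i) < 0"
    then have "refl i ` F = F" "refl i ` G = G"
      using refl_image_fundamental_face[OF F' _ neg] refl_image_fundamental_face[OF G' _ neg] by auto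
    then show "refl i ` (F \<inter> G) = F \<inter> G"
      by (simp add: image_Int[OF bij_is_inj[OF bij_refl]])
  qed
  then show ?thesis using face by (simp add: fundamental_faces_def)
qed

text \<open>If the midpoint lay outside the relative interior of the join, it would lie in a proper
  face. That face would contain both \<open>x\<close> and \<open>y\<close>, hence \<open>F\<close>
  and \<open>G\<close>, hence the join.\<close>

lemma fundamental_face_join:
  assumes F: "F \<in> fundamental_faces \<alpha>c (weight_hull \<alpha> \<alpha>c \<mu>)"
    and G: "G \<in> fundamental_faces \<alpha>c (weight_hull \<alpha> \<alpha>c \<mu>)"
  shows "face_join (weight_hull \<alpha> \<alpha>c \<mu>) F G \<in> fundamental_faces \<alpha>c (weight_hull \<alpha> \<alpha>c \<mu>)"
proof (cases "F = {} \<or> G = {}")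
  case True
  then show ?thesis
    using F G by (auto simp: fundamental_faces_def face_join_empty_left face_join_empty_right)
next
  case False
  let ?H = "weight_hull \<alpha> \<alpha>c \<mu>"
  let ?J = "face_join ?H F G"
  obtain x y where F': "F face_of ?H" "x \<in> rel_interior F" "x \<in> chamber"
    and G': "G face_of ?H" "y \<in> rel_interior G" "y \<in> chamber"
    using F G False by (auto simp: fundamental_faces_def)
  have J: "?J face_of ?H"
    using F'(1) G'(1) by (intro face_join_face_of) (simp_all add: weight_hull_def)
  have xy: "x \<in> ?J" "y \<in> ?J"
    using F'(2) G'(2) rel_interior_subset subset_face_join by (metis subsetD)+
  define m where "m = (1/2) *\<^sub>R x + (1/2) *\<^sub>R y"
  have convJ: "convex ?J" using J by (rule face_of_imp_convex)
  have mJ: "m \<in> ?J"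
    unfolding m_def using xy convJ by (intro convexD) auto
  have "m \<in> rel_interior ?J"
  proof (rule ccontr)
    assume "m \<notin> rel_interior ?J"
    then obtain T where T: "T face_of ?J" "m \<in> T" "T \<noteq> ?J"
      using proper_face_if_not_rel_interior[OF convJ mJ] by blast
    have "x \<in> T \<and> y \<in> T"
    proof (cases "x = y")
      case True
      then show ?thesis using T(2) by (simp add: m_def flip: scaleR_add_left)
    next
      case False
      then have "m \<in> open_segment x y"
        by (auto simp: in_segment m_def intro!: exI[of _ "1/2"])
      then show ?thesis
        using T(1,2) xy by (auto simp: face_of_def)
    qed
    moreover have TH: "T face_of ?H" using T(1) J by (rule face_of_trans)
    ultimately have "F \<subseteq> T" "G \<subseteq> T"
      using subset_of_face_of[OF TH face_of_imp_subset[OF F'(1)]]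
        subset_of_face_of[OF TH face_of_imp_subset[OF G'(1)]] F'(2) G'(2) by auto
    then have "?J \<subseteq> T" by (rule face_join_least[OF TH])
    then show False using T(1,3) face_of_imp_subset by blast
  qed
  moreover have "m \<in> chamber"
    using F'(3) G'(3) by (simp add: fundamental_chamber_def m_def blinfun.add_left blinfun.scaleR_left)
  ultimately show ?thesis
    using J by (auto simp: fundamental_faces_def)
qed

theorem fundamental_faces_sublattice:
  assumes \<mu>: "\<mu> \<in> chamber"
  shows "sublattice (fundamental_faces \<alpha>c (weight_hull \<alpha> \<alpha>c \<mu>)) (face_lattice (weight_hull \<alpha> \<alpha>c \<mu>))"
proof (rule sublattice_face_latticeI)
  let ?H = "weight_hull \<alpha> \<alpha>c \<mu>"
  show conv: "convex ?H" by (simp add: weight_hull_def)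
  have "\<mu> \<in> ?H"
    unfolding weight_hull_orbit by (intro hull_inc) (simp add: orbit.base)
  \<comment> \<open>The whole hull is stable under every simple reflection.\<close>
  then have "rel_interior ?H \<inter> chamber \<noteq> {}"
    by (intro rel_interior_meets_chamber[OF \<mu> conv]) (auto simp: refl_image_weight_hull)
  then show "?H \<in> fundamental_faces \<alpha>c ?H"
    using conv by (simp add: fundamental_faces_def face_of_refl)
qed (use fundamental_Int[OF \<mu>] fundamental_face_join in \<open>auto simp: fundamental_faces_def\<close>)

end

theorem corollary3p22:
  fixes A :: "int ^ 'n ^ 'n"
    and \<alpha> :: "'n \<Rightarrow> 'h::euclidean_space \<Rightarrow>\<^sub>L real"
    and \<alpha>c :: "'n \<Rightarrow> 'h"
    and \<mu> :: "'h \<Rightarrow>\<^sub>L real"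
  assumes "generalized_cartan_matrix A"
    and "realization A \<alpha> \<alpha>c"
    and "\<mu> \<in> fundamental_chamber \<alpha>c"
  shows "sublattice (fundamental_faces \<alpha>c (weight_hull \<alpha> \<alpha>c \<mu>))
                    (face_lattice (weight_hull \<alpha> \<alpha>c \<mu>))"
proof -
  have A: "\<alpha> j (\<alpha>c i) = real_of_int (A $ i $ j)" for i j
    using assms(2) by (simp add: realization_def)
  interpret reflection_datum \<alpha> \<alpha>c
    by unfold_locales
      (use assms(1,2) in \<open>auto simp: A generalized_cartan_matrix_def realization_def\<close>)
  show ?thesis
    using assms(3) by (rule fundamental_faces_sublattice)
qed

end
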